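(* Let $\mathtt{K}$ be a category and $\varOmega$, $\varPhi$ classes of morphisms in $\mathtt{K}$ such that: RE.1: $\mathtt{K}$ is projectively complete; RE.2: $\varOmega$ is monomorphically complementable in $\mathtt{K}$; RE.3: $\mathtt{K}$ is co-well-powered in the class $\varOmega$; RE.4: every object of $\mathtt{K}$ is the domain of some $\varphi\in\varPhi$, and $\varPhi$ is a right ideal: $\varphi\circ\alpha\in\varPhi$ for every $\varphi\in\varPhi$ and every morphism $\alpha$ of $\mathtt{K}$ composable with it. Then: (a) there is a net of epimorphisms $\mathcal{N}$ in $\mathtt{K}$ such that for each object $X$ of $\mathtt{K}$, in the factorization $\varprojlim\mathcal{N}^X=\mu\circ\varepsilon$ with $\mu\in{}^{\downarrow}\varOmega$ and $\varepsilon\in\varOmega$ of the local limit $\varprojlim\mathcal{N}^X:X\to X_{\mathcal N}$, the morphism $\varepsilon$ is an envelope $\mathrm{env}_{\varPhi}^{\varOmega}X$ of $X$ in $\varOmega$ with respect to $\varPhi$; (b) for each morphism $\alpha:X\to Y$ in $\mathtt{K}$ and any choice of envelopes $\mathrm{env}_{\varPhi}^{\varOmega}X:X\to \mathrm{Env}_{\varPhi}^{\varOmega}X$ and $\mathrm{env}_{\varPhi}^{\varOmega}Y:Y\to \mathrm{Env}_{\varPhi}^{\varOmega}Y$ there is a unique morphism $\mathrm{Env}_{\varPhi}^{\varOmega}\alpha:\mathrm{Env}_{\varPhi}^{\varOmega}X\to\mathrm{Env}_{\varPhi}^{\varOmega}Y$ such that $\mathrm{Env}_{\varPhi}^{\varOmega}\alpha\circ\mathrm{env}_{\varPhi}^{\varOmega}X=\mathrm{env}_{\varPhi}^{\varOmega}Y\circ\alpha$;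 (c) the envelope $\mathrm{Env}_{\varPhi}^{\varOmega}$ can be defined as a functor.
   Context: Set-theoretic foundation: Morse–Kelley class theory. $\mathrm{Dom}$ and $\mathrm{Ran}$ denote domain and range of a morphism. Projectively complete: every functor from a small category has a projective limit (limit). Extensions and envelopes. A morphism $\sigma:X\to X'$ is an extension of $X$ in $\varOmega$ with respect to $\varPhi$ if $\sigma\in\varOmega$ and for every morphism $\varphi:X\to B$ in $\varPhi$ there is a unique morphism $\varphi':X'\to B$ in $\mathtt{K}$ with $\varphi=\varphi'\circ\sigma$. An extension $\rho:X\to E$ is an envelope of $X$ in $\varOmega$ with respect to $\varPhi$ if for every extension $\sigma:X\to X'$ (in $\varOmega$ with respect to $\varPhi$) there is a unique morphism $\upsilon:X'\to E$ with $\rho=\upsilon\circ\sigma$; one writes $\rho=\mathrm{env}_\varPhi^\varOmega X$, $E=\mathrm{Env}_\varPhi^\varOmega X$. Complementability. For morphisms $\mu,\varepsilon$ write $\mu\downarrow\varepsilon$ if for all $\alpha:\mathrm{Dom}\,\varepsilon\to\mathrm{Dom}\,\mu$, $\beta:\mathrm{Ran}\,\varepsilon\to\mathrm{Ran}\,\mu$ with $\mu\circ\alpha=\beta\circ\varepsilon$ there is $\delta:\mathrm{Ran}\,\varepsilon\to\mathrm{Dom}\,\mu$ with $\delta\circ\varepsilon=\alpha$, $\mu\circ\delta=\beta$. For a class $\varLambda$ of morphisms, ${}^{\downarrow}\varLambda$ is the class of monomorphisms $\mu$ with $\mu\downarrow\lambda$ for all $\lambda\in\varLambda$, and $\varLambda^{\downarrow}$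 is the class of epimorphisms $\varepsilon$ with $\lambda\downarrow\varepsilon$ for all $\lambda\in\varLambda$. $\varOmega$ is monomorphically complementable if $\varOmega=({}^{\downarrow}\varOmega)^{\downarrow}$ and every morphism of $\mathtt{K}$ is of the form $\mu\circ\varepsilon$ with $\mu\in{}^{\downarrow}\varOmega$, $\varepsilon\in\varOmega$ (then $\varOmega$ consists of epimorphisms and such a factorization is unique up to isomorphism). $\mathtt{K}$ is co-well-powered in $\varOmega$ if for every object $X$ the category of morphisms in $\varOmega$ with domain $X$ (morphisms from $\rho:X\to A$ to $\sigma:X\to B$ being $\varkappa:A\to B$ with $\varkappa\circ\rho=\sigma$) has a skeleton which is a set. Nets. For epimorphisms $\rho,\sigma$ with common domain $X$, $\rho\to\sigma$ means that $\sigma=\iota\circ\rho$ for some (necessarily unique) morphism $\iota=\iota_\rho^\sigma$. A net of epimorphisms is a family $\mathcal N=\{\mathcal N^X\}_{X\in\mathrm{Ob}(\mathtt K)}$, where each $\mathcal{N}^X$ is a set of epimorphisms with domain $X$, such that (1) $\mathcal N^X$ is non-empty and for all $\sigma,\sigma'\in\mathcal N^X$ there is $\rho\in\mathcal N^X$ with $\rho\to\sigma$, $\rho\to\sigma'$; (2) the system of morphisms $\{\iota_\rho^\sigma:\rho,\sigma\in\mathcal N^X,\rho\to\sigma\}$ has a projective limit $X_{\mathcal N}$ in $\mathtt{K}$; (3) for every morphism $\alpha:X\to Y$ and every $\tau\in\mathcal N^Y$ there are $\sigma\in\mathcal N^X$ and $\alpha_\sigma^\tau:\mathrm{Ran}\,\sigma\to\mathrm{Ran}\,\tau$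 with $\alpha_\sigma^\tau\circ\sigma=\tau\circ\alpha$. The local limit $\varprojlim\mathcal N^X:X\to X_{\mathcal N}$ is the morphism to the projective limit induced by the cone $\mathcal N^X$. "$\mathrm{Env}_\varPhi^\varOmega$ can be defined as a functor" means: there are a map assigning to each object $X$ an envelope $e_X:X\to E(X)$ of $X$ in $\varOmega$ with respect to $\varPhi$, and a map assigning to each morphism $\alpha:X\to Y$ a morphism $E(\alpha):E(X)\to E(Y)$ with $E(\alpha)\circ e_X=e_Y\circ\alpha$, such that $E(1_X)=1_{E(X)}$ and $E(\beta\circ\alpha)=E(\beta)\circ E(\alpha)$. *)

theory Defs
  imports Main
begin

section \<open>The universe of sets\<close>

text \<open>
  Morse--Kelley class theory is rendered as follows. A type \<open>'v\<close> plays the role of the universe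
  of all sets and \<open>elts x\<close> is the extent of the set \<open>x\<close>; classes are the terms of type
  \<open>'v set\<close>. Full class comprehension and global choice are those of HOL.
  A class is a set iff it lies in \<open>range elts\<close>.
\<close>

locale mk_universe =
  fixes elts :: "'v \<Rightarrow> 'v set"
  assumes extensionality: "elts x = elts y \<Longrightarrow> x = y"
    and separation: "A \<subseteq> elts x \<Longrightarrow> A \<in> range elts"
    and pairing: "{x, y} \<in> range elts"
    and union: "(\<Union>y \<in> elts x. elts y) \<in> range elts"
    and power_set: "{y. elts y \<subseteq> elts x} \<in> range elts"
    and replacement: "f ` elts x \<in> range elts"
    and regularity: "A \<noteq> {} \<Longrightarrow> \<exists>x\<in>A. elts x \<inter> A = {}"
    and infinity: "\<exists>x. (\<exists>z\<in>elts x. elts z = {}) \<and>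
                     (\<forall>y\<in>elts x. \<exists>z\<in>elts x. elts z = insert y (elts y))"

text \<open>
  By replacement, for \<open>A :: 'v set\<close> this is the same as \<open>A \<in> range elts\<close>. The
  polymorphic form also covers classes of HOL pairs and triples of sets.
\<close>

definition small :: "('v \<Rightarrow> 'v set) \<Rightarrow> 'a set \<Rightarrow> bool" where
  "small elts A \<longleftrightarrow> (\<exists>f. inj_on f A \<and> f ` A \<in> range elts)"


section \<open>Categories, functors and limits\<close>

record ('o, 'm) cat =
  Ob :: "'o set"
  Mor :: "'m set"
  Dom :: "'m \<Rightarrow> 'o"
  Ran :: "'m \<Rightarrow> 'o"
  Ident :: "'o \<Rightarrow> 'm"
  Comp :: "'m \<Rightarrow> 'm \<Rightarrow> 'm"  (infixl "\<cdot>\<index>" 70)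

definition Hom :: "('o, 'm) cat \<Rightarrow> 'o \<Rightarrow> 'o \<Rightarrow> 'm set" where
  "Hom K X Y = {f \<in> Mor K. Dom K f = X \<and> Ran K f = Y}"

text \<open>
  The composition \<open>g \<cdot> f\<close> is meaningful only when \<open>Ran f = Dom g\<close>. The classes \<open>Hom K X Y\<close>
  are not required to be small.
\<close>

locale category =
  fixes K :: "('o, 'm) cat" (structure)
  assumes Dom_in_Ob: "f \<in> Mor K \<Longrightarrow> Dom K f \<in> Ob K"
    and Ran_in_Ob: "f \<in> Mor K \<Longrightarrow> Ran K f \<in> Ob K"
    and Ident_in_Hom: "X \<in> Ob K \<Longrightarrow> Ident K X \<in> Hom K X X"
    and Comp_in_Hom: "\<lbrakk>f \<in> Hom K X Y; g \<in> Hom K Y Z\<rbrakk> \<Longrightarrow> g \<cdot> f \<in> Hom K X Z"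
    and Comp_Ident: "f \<in> Mor K \<Longrightarrow> f \<cdot> Ident K (Dom K f) = f"
    and Ident_Comp: "f \<in> Mor K \<Longrightarrow> Ident K (Ran K f) \<cdot> f = f"
    and Comp_assoc: "\<lbrakk>f \<in> Hom K W X; g \<in> Hom K X Y; h \<in> Hom K Y Z\<rbrakk>
                     \<Longrightarrow> (h \<cdot> g) \<cdot> f = h \<cdot> (g \<cdot> f)"

definition small_category :: "('v \<Rightarrow> 'v set) \<Rightarrow> ('o, 'm) cat \<Rightarrow> bool" where
  "small_category elts C \<longleftrightarrow> category C \<and> small elts (Ob C) \<and> small elts (Mor C)"

definition is_functor ::
  "('o1, 'm1) cat \<Rightarrow> ('o2, 'm2) cat \<Rightarrow> ('o1 \<Rightarrow> 'o2) \<Rightarrow> ('m1 \<Rightarrow> 'm2) \<Rightarrow> bool" where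
  "is_functor J K Fo Fm \<longleftrightarrow> category J \<and> category K \<and>
     (\<forall>i \<in> Ob J. Fo i \<in> Ob K) \<and>
     (\<forall>u \<in> Mor J. Fm u \<in> Hom K (Fo (Dom J u)) (Fo (Ran J u))) \<and>
     (\<forall>i \<in> Ob J. Fm (Ident J i) = Ident K (Fo i)) \<and>
     (\<forall>u \<in> Mor J. \<forall>v \<in> Mor J. Ran J u = Dom J v \<longrightarrow>
        Fm (v \<cdot>\<^bsub>J\<^esub> u) = Fm v \<cdot>\<^bsub>K\<^esub> Fm u)"

definition is_cone ::
  "('o1, 'm1) cat \<Rightarrow> ('o2, 'm2) cat \<Rightarrow> ('o1 \<Rightarrow> 'o2) \<Rightarrow> ('m1 \<Rightarrow> 'm2) \<Rightarrow>
   'o2 \<Rightarrow> ('o1 \<Rightarrow> 'm2) \<Rightarrow> bool" where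
  "is_cone J K Fo Fm L p \<longleftrightarrow> L \<in> Ob K \<and>
     (\<forall>i \<in> Ob J. p i \<in> Hom K L (Fo i)) \<and>
     (\<forall>u \<in> Mor J. Fm u \<cdot>\<^bsub>K\<^esub> p (Dom J u) = p (Ran J u))"

definition is_limit ::
  "('o1, 'm1) cat \<Rightarrow> ('o2, 'm2) cat \<Rightarrow> ('o1 \<Rightarrow> 'o2) \<Rightarrow> ('m1 \<Rightarrow> 'm2) \<Rightarrow>
   'o2 \<Rightarrow> ('o1 \<Rightarrow> 'm2) \<Rightarrow> bool" where
  "is_limit J K Fo Fm L p \<longleftrightarrow> is_cone J K Fo Fm L p \<and>
     (\<forall>Y q. is_cone J K Fo Fm Y q \<longrightarrow>
        (\<exists>!h. h \<in> Hom K Y L \<and> (\<forall>i \<in> Ob J. p i \<cdot>\<^bsub>K\<^esub> h = q i)))"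

text \<open>
  Objects and morphisms of a small category are sets, so the index categories range over
  categories carried by the universe \<open>'v\<close>.
\<close>

definition projectively_complete :: "('v \<Rightarrow> 'v set) \<Rightarrow> ('o, 'm) cat \<Rightarrow> bool" where
  "projectively_complete elts K \<longleftrightarrow>
     (\<forall>(J :: ('v, 'v) cat) Fo Fm. small_category elts J \<and> is_functor J K Fo Fm \<longrightarrow>
        (\<exists>L p. is_limit J K Fo Fm L p))"


section \<open>Complementability\<close>

definition is_mono :: "('o, 'm) cat \<Rightarrow> 'm \<Rightarrow> bool" where
  "is_mono K m \<longleftrightarrow> m \<in> Mor K \<and>
     (\<forall>Z. \<forall>f \<in> Hom K Z (Dom K m). \<forall>g \<in> Hom K Z (Dom K m).
        m \<cdot>\<^bsub>K\<^esub> f = m \<cdot>\<^bsub>K\<^esub> g \<longrightarrow> f = g)"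

definition is_epi :: "('o, 'm) cat \<Rightarrow> 'm \<Rightarrow> bool" where
  "is_epi K e \<longleftrightarrow> e \<in> Mor K \<and>
     (\<forall>Z. \<forall>f \<in> Hom K (Ran K e) Z. \<forall>g \<in> Hom K (Ran K e) Z.
        f \<cdot>\<^bsub>K\<^esub> e = g \<cdot>\<^bsub>K\<^esub> e \<longrightarrow> f = g)"

definition lifts :: "('o, 'm) cat \<Rightarrow> 'm \<Rightarrow> 'm \<Rightarrow> bool" where
  "lifts K m e \<longleftrightarrow>
     (\<forall>\<alpha> \<in> Hom K (Dom K e) (Dom K m). \<forall>\<beta> \<in> Hom K (Ran K e) (Ran K m).
        m \<cdot>\<^bsub>K\<^esub> \<alpha> = \<beta> \<cdot>\<^bsub>K\<^esub> e \<longrightarrow>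
        (\<exists>\<delta> \<in> Hom K (Ran K e) (Dom K m). \<delta> \<cdot>\<^bsub>K\<^esub> e = \<alpha> \<and> m \<cdot>\<^bsub>K\<^esub> \<delta> = \<beta>))"

definition pre_down :: "('o, 'm) cat \<Rightarrow> 'm set \<Rightarrow> 'm set" where
  "pre_down K \<Lambda> = {m. is_mono K m \<and> (\<forall>l \<in> \<Lambda>. lifts K m l)}"

definition post_down :: "('o, 'm) cat \<Rightarrow> 'm set \<Rightarrow> 'm set" where
  "post_down K \<Lambda> = {e. is_epi K e \<and> (\<forall>l \<in> \<Lambda>. lifts K l e)}"

definition is_factorization :: "('o, 'm) cat \<Rightarrow> 'm set \<Rightarrow> 'm \<Rightarrow> 'm \<Rightarrow> 'm \<Rightarrow> bool" where
  "is_factorization K \<Omega> f m e \<longleftrightarrow>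
     m \<in> pre_down K \<Omega> \<and> e \<in> \<Omega> \<and> Ran K e = Dom K m \<and> f = m \<cdot>\<^bsub>K\<^esub> e"

definition mono_complementable :: "('o, 'm) cat \<Rightarrow> 'm set \<Rightarrow> bool" where
  "mono_complementable K \<Omega> \<longleftrightarrow>
     \<Omega> = post_down K (pre_down K \<Omega>) \<and>
     (\<forall>f \<in> Mor K. \<exists>m e. is_factorization K \<Omega> f m e)"


section \<open>Co-well-poweredness\<close>

definition isomorphic :: "('o, 'm) cat \<Rightarrow> 'o \<Rightarrow> 'o \<Rightarrow> bool" where
  "isomorphic C X Y \<longleftrightarrow>
     (\<exists>f \<in> Hom C X Y. \<exists>g \<in> Hom C Y X. g \<cdot>\<^bsub>C\<^esub> f = Ident C X \<and> f \<cdot>\<^bsub>C\<^esub> g = Ident C Y)"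

definition full_subcategory :: "('o, 'm) cat \<Rightarrow> 'o set \<Rightarrow> ('o, 'm) cat" where
  "full_subcategory C S = C\<lparr>Ob := S, Mor := {f \<in> Mor C. Dom C f \<in> S \<and> Ran C f \<in> S}\<rparr>"

definition is_skeleton :: "('o, 'm) cat \<Rightarrow> ('o, 'm) cat \<Rightarrow> bool" where
  "is_skeleton C D \<longleftrightarrow>
     (\<exists>S \<subseteq> Ob C. D = full_subcategory C S \<and>
        (\<forall>X \<in> Ob C. \<exists>!Y. Y \<in> S \<and> isomorphic C X Y))"

text \<open>
  A morphism from \<open>\<rho>\<close> to \<open>\<sigma>\<close> is the triple \<open>(\<rho>, \<kappa>, \<sigma>)\<close>, since \<open>\<kappa>\<close> alone does not determine
  its source.
\<close>

definition under_category :: "('o, 'm) cat \<Rightarrow> 'm set \<Rightarrow> 'o \<Rightarrow> ('m, 'm \<times> 'm \<times> 'm) cat" where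
  "under_category K \<Omega> X =
     \<lparr>Ob = {\<rho> \<in> \<Omega>. Dom K \<rho> = X},
      Mor = {(\<rho>, \<kappa>, \<sigma>). \<rho> \<in> \<Omega> \<and> Dom K \<rho> = X \<and> \<sigma> \<in> \<Omega> \<and> Dom K \<sigma> = X \<and>
               \<kappa> \<in> Hom K (Ran K \<rho>) (Ran K \<sigma>) \<and> \<kappa> \<cdot>\<^bsub>K\<^esub> \<rho> = \<sigma>},
      Dom = (\<lambda>(\<rho>, \<kappa>, \<sigma>). \<rho>),
      Ran = (\<lambda>(\<rho>, \<kappa>, \<sigma>). \<sigma>),
      Ident = (\<lambda>\<rho>. (\<rho>, Ident K (Ran K \<rho>), \<rho>)),
      Comp = (\<lambda>(\<sigma>, \<kappa>', \<tau>) (\<rho>, \<kappa>, \<sigma>'). (\<rho>, \<kappa>' \<cdot>\<^bsub>K\<^esub> \<kappa>, \<tau>))\<rparr>"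

definition co_well_powered :: "('v \<Rightarrow> 'v set) \<Rightarrow> ('o, 'm) cat \<Rightarrow> 'm set \<Rightarrow> bool" where
  "co_well_powered elts K \<Omega> \<longleftrightarrow>
     (\<forall>X \<in> Ob K. \<exists>D. is_skeleton (under_category K \<Omega> X) D \<and> small_category elts D)"


section \<open>Extensions and envelopes\<close>

definition is_extension :: "('o, 'm) cat \<Rightarrow> 'm set \<Rightarrow> 'm set \<Rightarrow> 'o \<Rightarrow> 'm \<Rightarrow> bool" where
  "is_extension K \<Omega> \<Phi> X \<sigma> \<longleftrightarrow> \<sigma> \<in> Mor K \<and> Dom K \<sigma> = X \<and> \<sigma> \<in> \<Omega> \<and>
     (\<forall>\<phi> \<in> \<Phi>. Dom K \<phi> = X \<longrightarrow>
        (\<exists>!\<phi>'. \<phi>' \<in> Hom K (Ran K \<sigma>) (Ran K \<phi>) \<and> \<phi> = \<phi>' \<cdot>\<^bsub>K\<^esub> \<sigma>))"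

definition is_envelope :: "('o, 'm) cat \<Rightarrow> 'm set \<Rightarrow> 'm set \<Rightarrow> 'o \<Rightarrow> 'm \<Rightarrow> bool" where
  "is_envelope K \<Omega> \<Phi> X \<rho> \<longleftrightarrow> is_extension K \<Omega> \<Phi> X \<rho> \<and>
     (\<forall>\<sigma>. is_extension K \<Omega> \<Phi> X \<sigma> \<longrightarrow>
        (\<exists>!\<upsilon>. \<upsilon> \<in> Hom K (Ran K \<sigma>) (Ran K \<rho>) \<and> \<rho> = \<upsilon> \<cdot>\<^bsub>K\<^esub> \<sigma>))"

definition is_envelope_functor ::
  "('o, 'm) cat \<Rightarrow> 'm set \<Rightarrow> 'm set \<Rightarrow> ('o \<Rightarrow> 'm) \<Rightarrow> ('m \<Rightarrow> 'm) \<Rightarrow> bool" where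
  "is_envelope_functor K \<Omega> \<Phi> e E \<longleftrightarrow>
     (\<forall>X \<in> Ob K. is_envelope K \<Omega> \<Phi> X (e X)) \<and>
     (\<forall>X \<in> Ob K. \<forall>Y \<in> Ob K. \<forall>\<alpha> \<in> Hom K X Y.
        E \<alpha> \<in> Hom K (Ran K (e X)) (Ran K (e Y)) \<and> E \<alpha> \<cdot>\<^bsub>K\<^esub> e X = e Y \<cdot>\<^bsub>K\<^esub> \<alpha>) \<and>
     (\<forall>X \<in> Ob K. E (Ident K X) = Ident K (Ran K (e X))) \<and>
     (\<forall>\<alpha> \<in> Mor K. \<forall>\<beta> \<in> Mor K. Ran K \<alpha> = Dom K \<beta> \<longrightarrow>
        E (\<beta> \<cdot>\<^bsub>K\<^esub> \<alpha>) = E \<beta> \<cdot>\<^bsub>K\<^esub> E \<alpha>)"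


section \<open>Nets of epimorphisms\<close>

definition precedes :: "('o, 'm) cat \<Rightarrow> 'm \<Rightarrow> 'm \<Rightarrow> bool" where
  "precedes K \<rho> \<sigma> \<longleftrightarrow> (\<exists>\<iota>. \<iota> \<in> Hom K (Ran K \<rho>) (Ran K \<sigma>) \<and> \<sigma> = \<iota> \<cdot>\<^bsub>K\<^esub> \<rho>)"

definition connecting :: "('o, 'm) cat \<Rightarrow> 'm \<Rightarrow> 'm \<Rightarrow> 'm" where
  "connecting K \<rho> \<sigma> = (THE \<iota>. \<iota> \<in> Hom K (Ran K \<rho>) (Ran K \<sigma>) \<and> \<sigma> = \<iota> \<cdot>\<^bsub>K\<^esub> \<rho>)"

text \<open>The preordered class \<open>S\<close> of epimorphisms as a category: one arrow for each \<open>\<rho> \<rightarrow> \<sigma>\<close>.\<close>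

definition order_category :: "('o, 'm) cat \<Rightarrow> 'm set \<Rightarrow> ('m, 'm \<times> 'm) cat" where
  "order_category K S =
     \<lparr>Ob = S,
      Mor = {(\<rho>, \<sigma>). \<rho> \<in> S \<and> \<sigma> \<in> S \<and> precedes K \<rho> \<sigma>},
      Dom = fst,
      Ran = snd,
      Ident = (\<lambda>\<rho>. (\<rho>, \<rho>)),
      Comp = (\<lambda>(\<sigma>, \<tau>) (\<rho>, \<sigma>'). (\<rho>, \<tau>))\<rparr>"

definition is_system_limit :: "('o, 'm) cat \<Rightarrow> 'm set \<Rightarrow> 'o \<Rightarrow> ('m \<Rightarrow> 'm) \<Rightarrow> bool" where
  "is_system_limit K S L p \<longleftrightarrow>
     is_limit (order_category K S) K (Ran K) (\<lambda>(\<rho>, \<sigma>). connecting K \<rho> \<sigma>) L p"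

definition is_net :: "('v \<Rightarrow> 'v set) \<Rightarrow> ('o, 'm) cat \<Rightarrow> ('o \<Rightarrow> 'm set) \<Rightarrow> bool" where
  "is_net elts K N \<longleftrightarrow>
     (\<forall>X \<in> Ob K. small elts (N X) \<and> (\<forall>\<sigma> \<in> N X. is_epi K \<sigma> \<and> Dom K \<sigma> = X)) \<and>
     (\<forall>X \<in> Ob K. N X \<noteq> {} \<and>
        (\<forall>\<sigma> \<in> N X. \<forall>\<sigma>' \<in> N X. \<exists>\<rho> \<in> N X. precedes K \<rho> \<sigma> \<and> precedes K \<rho> \<sigma>')) \<and>
     (\<forall>X \<in> Ob K. \<exists>L p. is_system_limit K (N X) L p) \<and>
     (\<forall>X \<in> Ob K. \<forall>Y \<in> Ob K. \<forall>\<alpha> \<in> Hom K X Y. \<forall>\<tau> \<in> N Y.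
        \<exists>\<sigma> \<in> N X. \<exists>\<alpha>' \<in> Hom K (Ran K \<sigma>) (Ran K \<tau>). \<alpha>' \<cdot>\<^bsub>K\<^esub> \<sigma> = \<tau> \<cdot>\<^bsub>K\<^esub> \<alpha>)"

text \<open>
  A local limit depends on the choice of a projective limit of the system, hence is a relation.
\<close>

definition is_local_limit :: "('o, 'm) cat \<Rightarrow> ('o \<Rightarrow> 'm set) \<Rightarrow> 'o \<Rightarrow> 'm \<Rightarrow> bool" where
  "is_local_limit K N X l \<longleftrightarrow>
     (\<exists>L p. is_system_limit K (N X) L p \<and> l \<in> Hom K X L \<and>
        (\<forall>\<sigma> \<in> N X. p \<sigma> \<cdot>\<^bsub>K\<^esub> l = \<sigma>))"

end

theory Submission
  imports Defs
begin

text \<open>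
  Factor the morphisms of \<open>\<Phi>\<close> with domain \<open>X\<close> as \<open>\<mu> \<circ> \<epsilon>\<close>. Up to isomorphism, only a set of
  morphisms \<open>\<epsilon>\<close> arises, so they induce a morphism from \<open>X\<close> into the product of their ranges; let
  \<open>\<rho>\<close> be the \<open>\<Omega>\<close>-part of that morphism. Every morphism of \<open>\<Phi>\<close> factors through \<open>\<rho>\<close>. Conversely,
  for \<open>\<alpha> : W \<rightarrow> X\<close> and an extension \<open>\<sigma>\<close> of \<open>W\<close>, the morphism \<open>\<mu> \<circ> \<epsilon> \<circ> \<alpha>\<close> lies in the right ideal
  \<open>\<Phi>\<close>, hence extends along \<open>\<sigma>\<close>; lifting against \<open>\<mu>\<close> shows that \<open>\<epsilon> \<circ> \<alpha>\<close> factors through \<open>\<sigma>\<close>, and a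
  second lifting shows the same for \<open>\<rho> \<circ> \<alpha>\<close>. The case \<open>\<alpha> = 1\<close> says that \<open>\<rho>\<close> is an envelope, and
  the general case gives functoriality. Since the envelopes are functorial epimorphisms, the one-element
  families \<open>{\<rho>}\<close> already form a net.
\<close>

section \<open>Categories with chosen classes of morphisms\<close>

context category
begin

section \<open>Endpoints of morphisms, cancellation and lifting\<close>

lemma Mor_in_Hom: "f \<in> Mor K \<Longrightarrow> f \<in> Hom K (Dom K f) (Ran K f)"
  by (simp add: Hom_def)

lemma HomD:
  assumes "f \<in> Hom K X Y"
  shows "f \<in> Mor K" "Dom K f = X" "Ran K f = Y" "X \<in> Ob K" "Y \<in> Ob K"
  using assms Dom_in_Ob Ran_in_Ob by (auto simp: Hom_def)

lemma Ident_right: "f \<in> Hom K X Y \<Longrightarrow> f \<cdot> Ident K X = f"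
  using Comp_Ident HomD by metis

lemma Ident_left: "f \<in> Hom K X Y \<Longrightarrow> Ident K Y \<cdot> f = f"
  using Ident_Comp HomD by metis

lemma epi_cancel:
  assumes "is_epi K e" "e \<in> Hom K X Y" "f \<in> Hom K Y Z" "g \<in> Hom K Y Z" "f \<cdot> e = g \<cdot> e"
  shows "f = g"
  using assms HomD(3)[OF assms(2)] unfolding is_epi_def by metis

lemma pre_down_lift:
  assumes "m \<in> pre_down K \<Omega>" "s \<in> \<Omega>" "m \<in> Hom K A B" "s \<in> Hom K X Y"
    and "a \<in> Hom K X A" "b \<in> Hom K Y B" "m \<cdot> a = b \<cdot> s"
  obtains d where "d \<in> Hom K Y A" "d \<cdot> s = a" "m \<cdot> d = b"
  using assms HomD(2,3)[OF assms(3)] HomD(2,3)[OF assms(4)]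
  unfolding pre_down_def lifts_def by blast

lemma factorization_HomE:
  assumes "is_factorization K \<Omega> f m e" "\<Omega> \<subseteq> Mor K" "f \<in> Hom K X Y"
  obtains A where "e \<in> Hom K X A" "m \<in> Hom K A Y" "f = m \<cdot> e" "m \<in> pre_down K \<Omega>" "e \<in> \<Omega>"
proof -
  have f: "m \<in> pre_down K \<Omega>" "e \<in> \<Omega>" "Ran K e = Dom K m" "f = m \<cdot> e"
    using assms(1) by (auto simp: is_factorization_def)
  then have e: "e \<in> Hom K (Dom K e) (Dom K m)" and m: "m \<in> Hom K (Dom K m) (Ran K m)"
    using assms(2) by (auto simp: Hom_def pre_down_def is_mono_def)
  then have "f \<in> Hom K (Dom K e) (Ran K m)"
    using Comp_in_Hom f(4) by blast
  then have "Dom K e = X" "Ran K m = Y"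
    using assms(3) by (auto simp: Hom_def)
  then show thesis using that e m f by blast
qed

lemma under_category_HomD:
  assumes "f \<in> Hom (under_category K \<Omega> X) \<rho> \<sigma>"
  shows "\<exists>k \<in> Hom K (Ran K \<rho>) (Ran K \<sigma>). k \<cdot> \<rho> = \<sigma>"
  \<comment> \<open>Only the outer \<open>Hom\<close> is unfolded: \<open>Hom K\<close> must survive
    as the type of the middle component of the triple.\<close>
  using assms unfolding Hom_def[of "under_category K \<Omega> X"] by (auto simp: under_category_def)

section \<open>Products as limits of discrete diagrams\<close>

lemma discrete_product:
  fixes elts :: "'v \<Rightarrow> 'v set" and I :: "'v set"
  assumes "projectively_complete elts K" "small elts I" "\<And>i. i \<in> I \<Longrightarrow> F i \<in> Ob K"
  obtains L p where "L \<in> Ob K" "\<And>i. i \<in> I \<Longrightarrow> p i \<in> Hom K L (F i)"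
    "\<And>Y q. Y \<in> Ob K \<Longrightarrow> (\<And>i. i \<in> I \<Longrightarrow> q i \<in> Hom K Y (F i)) \<Longrightarrow>
       \<exists>!h. h \<in> Hom K Y L \<and> (\<forall>i \<in> I. p i \<cdot> h = q i)"
proof -
  \<comment> \<open>The discrete category on \<open>I\<close>: each index is its own identity arrow,
    so composable arrows coincide. It is carried by \<open>'v\<close>, as
    \<open>projectively_complete\<close> requires.\<close>
  define J :: "('v, 'v) cat" where
    "J = \<lparr>Ob = I, Mor = I, Dom = id, Ran = id, Ident = id, Comp = (\<lambda>g f. f)\<rparr>"
  let ?Fm = "\<lambda>i. Ident K (F i)"
  have J: "category J"
    by unfold_locales (auto simp: J_def Hom_def)
  then have "small_category elts J"
    using assms(2) by (simp add: small_category_def J_def)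
  moreover have "is_functor J K F ?Fm"
    unfolding is_functor_def using J category_axioms assms(3)
    by (auto simp: J_def intro: Ident_in_Hom Ident_left[symmetric])
  ultimately obtain L p where L: "is_limit J K F ?Fm L p"
    using assms(1) unfolding projectively_complete_def by blast
  \<comment> \<open>All arrows go to identities, so any family of legs is a cone and the limit is a
    product.\<close>
  have cone: "is_cone J K F ?Fm Y q" if "Y \<in> Ob K" "\<And>i. i \<in> I \<Longrightarrow> q i \<in> Hom K Y (F i)" for Y q
    using that unfolding is_cone_def by (auto simp: J_def intro: Ident_left)
  show thesis
  proof (rule that)
    show "L \<in> Ob K" "\<And>i. i \<in> I \<Longrightarrow> p i \<in> Hom K L (F i)"
      using L by (auto simp: is_limit_def is_cone_def J_def)
    show "\<exists>!h. h \<in> Hom K Y L \<and> (\<forall>i \<in> I. p i \<cdot> h = q i)"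
      if "Y \<in> Ob K" "\<And>i. i \<in> I \<Longrightarrow> q i \<in> Hom K Y (F i)" for Y q
      using L cone[OF that] unfolding is_limit_def by (auto simp: J_def)
  qed
qed

section \<open>Systems consisting of one epimorphism\<close>

text \<open>The only arrow is \<open>(\<sigma>, \<sigma>)\<close>, and cancelling the epimorphism
  makes its connecting morphism the identity, so compatibility of the legs is automatic.\<close>

lemma singleton_cone_iff:
  assumes "is_epi K \<sigma>"
  shows "is_cone (order_category K {\<sigma>}) K (Ran K) (\<lambda>(\<rho>, \<tau>). connecting K \<rho> \<tau>) Y q \<longleftrightarrow>
           q \<sigma> \<in> Hom K Y (Ran K \<sigma>)"
proof -
  have s: "\<sigma> \<in> Hom K (Dom K \<sigma>) (Ran K \<sigma>)"
    using assms by (simp add: is_epi_def Mor_in_Hom)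
  note id = Ident_in_Hom[OF HomD(5)[OF s]]
  have ids: "Ident K (Ran K \<sigma>) \<cdot> \<sigma> = \<sigma>"
    using Ident_left[OF s] .
  have "connecting K \<sigma> \<sigma> = Ident K (Ran K \<sigma>)"
    unfolding connecting_def
  proof (rule the_equality)
    fix k assume "k \<in> Hom K (Ran K \<sigma>) (Ran K \<sigma>) \<and> \<sigma> = k \<cdot> \<sigma>"
    then show "k = Ident K (Ran K \<sigma>)"
      using epi_cancel[OF assms s _ id] ids by metis
  qed (use id ids in auto)
  then show ?thesis
    unfolding is_cone_def
    by (auto simp: order_category_def Ident_left dest: HomD(4))
qed

lemma singleton_system_limit:
  assumes "is_epi K \<sigma>"
  shows "is_system_limit K {\<sigma>} (Ran K \<sigma>) (\<lambda>_. Ident K (Ran K \<sigma>))"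
proof -
  have "Ran K \<sigma> \<in> Ob K"
    using assms Ran_in_Ob by (simp add: is_epi_def)
  note id = Ident_in_Hom[OF this]
  show ?thesis
    unfolding is_system_limit_def is_limit_def singleton_cone_iff[OF assms]
    using id by (auto simp: order_category_def Ident_left)
qed

text \<open>A local limit may use any projective limit \<open>L\<close>, so it agrees with \<sigma>
  only up to comparison: \<open>g\<close> is the projection and \<open>h\<close> is induced by the
  identity.\<close>

lemma singleton_local_limit:
  assumes "is_epi K \<sigma>" "\<sigma> \<in> Hom K X Y" "is_local_limit K (\<lambda>X. {s X}) X l" "s X = \<sigma>"
  obtains L g h where "l \<in> Hom K X L" "g \<in> Hom K L Y" "h \<in> Hom K Y L" "g \<cdot> l = \<sigma>" "h \<cdot> \<sigma> = l"
proof -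
  have Y: "Ran K \<sigma> = Y"
    using HomD(3)[OF assms(2)] .
  obtain L p where lim: "is_system_limit K {\<sigma>} L p" and l: "l \<in> Hom K X L" "p \<sigma> \<cdot> l = \<sigma>"
    using assms(3,4) by (auto simp: is_local_limit_def)
  from lim have p: "p \<sigma> \<in> Hom K L Y"
    and univ: "\<And>Z q. q \<sigma> \<in> Hom K Z Y \<Longrightarrow> \<exists>!h. h \<in> Hom K Z L \<and> p \<sigma> \<cdot> h = q \<sigma>"
    unfolding is_system_limit_def is_limit_def singleton_cone_iff[OF assms(1)] Y
    by (auto simp: order_category_def)
  have id: "Ident K Y \<in> Hom K Y Y"
    using HomD(5)[OF assms(2)] Ident_in_Hom by blast
  obtain h where h: "h \<in> Hom K Y L" "p \<sigma> \<cdot> h = Ident K Y"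
    using univ[of "\<lambda>_. Ident K Y", OF id] by blast
  have hs: "h \<cdot> \<sigma> \<in> Hom K X L"
    using Comp_in_Hom[OF assms(2) h(1)] .
  have "p \<sigma> \<cdot> (h \<cdot> \<sigma>) = \<sigma>"
    using Comp_assoc[OF assms(2) h(1) p] h(2) Ident_left[OF assms(2)] by simp
  \<comment> \<open>Both sides mediate the cone with leg \<sigma>.\<close>
  then have "h \<cdot> \<sigma> = l"
    using univ[of "\<lambda>_. \<sigma>", OF assms(2)] hs l by blast
  then show thesis
    using that l p h by blast
qed

end

section \<open>Small classes\<close>

lemma (in mk_universe) small_subset:
  assumes "small elts A" "B \<subseteq> A"
  shows "small elts B"
proof -
  obtain f x where f: "inj_on f A" "f ` A = elts x"
    using assms(1) by (auto simp: small_def)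
  then have "f ` B \<in> range elts"
    using assms(2) by (intro separation[of _ x]) blast
  moreover have "inj_on f B"
    using f(1) assms(2) by (rule inj_on_subset)
  ultimately show ?thesis
    unfolding small_def by blast
qed

lemma (in mk_universe) small_singleton: "small elts {x :: 'v}"
  using pairing[of x x] by (auto simp: small_def intro!: exI[of _ id])


section \<open>Envelopes\<close>

text \<open>Morphisms live in \<open>'v\<close> because representatives of \<Omega>-morphisms will
  themselves index a product; objects may have any type.\<close>

locale regular_envelope = mk_universe elts + category K
  for elts :: "'v \<Rightarrow> 'v set" and K :: "('o, 'v) cat" (structure) +
  fixes \<Omega> \<Phi> :: "'v set"
  assumes Omega_Mor: "\<Omega> \<subseteq> Mor K"
    and Phi_Mor: "\<Phi> \<subseteq> Mor K"
    and complete: "projectively_complete elts K"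
    and complementable: "mono_complementable K \<Omega>"
    and co_well: "co_well_powered elts K \<Omega>"
    and Phi_comp: "\<phi> \<in> \<Phi> \<Longrightarrow> \<alpha> \<in> Mor K \<Longrightarrow> Ran K \<alpha> = Dom K \<phi> \<Longrightarrow> \<phi> \<cdot> \<alpha> \<in> \<Phi>"
begin

section \<open>Extensions and envelopes as epimorphisms\<close>

lemma Omega_epi: "e \<in> \<Omega> \<Longrightarrow> is_epi K e"
  using complementable unfolding mono_complementable_def post_down_def by blast

lemma Omega_Hom: "e \<in> \<Omega> \<Longrightarrow> e \<in> Hom K (Dom K e) (Ran K e)"
  using Omega_Mor Mor_in_Hom by blast

text \<open>Since \<Omega> consists of epimorphisms, uniqueness comes from cancelling \<sigma>, and
  only existence has to be checked.\<close>

lemma extensionI: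
  assumes "\<sigma> \<in> \<Omega>" "\<sigma> \<in> Hom K X Y"
    and "\<And>\<phi> B. \<phi> \<in> \<Phi> \<Longrightarrow> \<phi> \<in> Hom K X B \<Longrightarrow> \<exists>\<phi>' \<in> Hom K Y B. \<phi> = \<phi>' \<cdot> \<sigma>"
  shows "is_extension K \<Omega> \<Phi> X \<sigma>"
  unfolding is_extension_def
proof (intro conjI ballI impI)
  show "\<sigma> \<in> Mor K" "Dom K \<sigma> = X" "\<sigma> \<in> \<Omega>"
    using assms(1) HomD[OF assms(2)] by auto
  fix \<phi> assume "\<phi> \<in> \<Phi>" "Dom K \<phi> = X"
  then obtain \<phi>' where "\<phi>' \<in> Hom K Y (Ran K \<phi>)" "\<phi> = \<phi>' \<cdot> \<sigma>"
    using assms(3) Phi_Mor Mor_in_Hom by blast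
  then show "\<exists>!\<phi>'. \<phi>' \<in> Hom K (Ran K \<sigma>) (Ran K \<phi>) \<and> \<phi> = \<phi>' \<cdot> \<sigma>"
    using epi_cancel[OF Omega_epi[OF assms(1)] assms(2)] HomD(3)[OF assms(2)] by metis
qed

lemma extensionD:
  assumes "is_extension K \<Omega> \<Phi> X \<sigma>"
  shows "\<sigma> \<in> \<Omega>" "\<sigma> \<in> Hom K X (Ran K \<sigma>)" "is_epi K \<sigma>"
    and "\<phi> \<in> \<Phi> \<Longrightarrow> \<phi> \<in> Hom K X B \<Longrightarrow> \<exists>\<phi>' \<in> Hom K (Ran K \<sigma>) B. \<phi> = \<phi>' \<cdot> \<sigma>"
proof -
  show "\<sigma> \<in> \<Omega>" "\<sigma> \<in> Hom K X (Ran K \<sigma>)" "is_epi K \<sigma>"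
    using assms Omega_epi by (simp_all add: is_extension_def Hom_def)
  show "\<exists>\<phi>' \<in> Hom K (Ran K \<sigma>) B. \<phi> = \<phi>' \<cdot> \<sigma>" if "\<phi> \<in> \<Phi>" "\<phi> \<in> Hom K X B"
    using assms that HomD(2,3)[OF that(2)] unfolding is_extension_def by blast
qed

text \<open>Here uniqueness comes from cancelling the competing extension \<sigma>, again an
  epimorphism.\<close>

lemma envelopeI:
  assumes "is_extension K \<Omega> \<Phi> X \<rho>"
    and "\<And>\<sigma>. is_extension K \<Omega> \<Phi> X \<sigma> \<Longrightarrow> \<exists>\<upsilon> \<in> Hom K (Ran K \<sigma>) (Ran K \<rho>). \<rho> = \<upsilon> \<cdot> \<sigma>"
  shows "is_envelope K \<Omega> \<Phi> X \<rho>"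
  unfolding is_envelope_def
proof (intro conjI allI impI assms(1))
  fix \<sigma> assume \<sigma>: "is_extension K \<Omega> \<Phi> X \<sigma>"
  show "\<exists>!\<upsilon>. \<upsilon> \<in> Hom K (Ran K \<sigma>) (Ran K \<rho>) \<and> \<rho> = \<upsilon> \<cdot> \<sigma>"
    using assms(2)[OF \<sigma>] by (auto intro: epi_cancel[OF extensionD(3,2)[OF \<sigma>]])
qed

lemma envelopeD:
  assumes "is_envelope K \<Omega> \<Phi> X \<rho>"
  shows "is_extension K \<Omega> \<Phi> X \<rho>"
    and "is_extension K \<Omega> \<Phi> X \<sigma> \<Longrightarrow> \<exists>\<upsilon> \<in> Hom K (Ran K \<sigma>) (Ran K \<rho>). \<rho> = \<upsilon> \<cdot> \<sigma>"
  using assms unfolding is_envelope_def by blast+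

section \<open>Construction of a natural extension\<close>

text \<open>An isomorphism in the under category yields two triangles in \<open>K\<close>, so
  \<open>e\<close> and its representative factor through each other.\<close>

lemma skeleton_representatives:
  assumes "X \<in> Ob K"
  obtains S where "small elts S" "\<And>i. i \<in> S \<Longrightarrow> i \<in> \<Omega> \<and> i \<in> Hom K X (Ran K i)"
    "\<And>e. e \<in> \<Omega> \<Longrightarrow> Dom K e = X \<Longrightarrow>
       \<exists>i \<in> S. (\<exists>k \<in> Hom K (Ran K e) (Ran K i). k \<cdot> e = i) \<and>
               (\<exists>k \<in> Hom K (Ran K i) (Ran K e). k \<cdot> i = e)"
proof -
  let ?C = "under_category K \<Omega> X"
  obtain D where D: "is_skeleton ?C D" "small_category elts D"
    using co_well assms unfolding co_well_powered_def by blast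
  then obtain S where S: "S \<subseteq> Ob ?C" "D = full_subcategory ?C S"
    "\<forall>e \<in> Ob ?C. \<exists>!i. i \<in> S \<and> isomorphic ?C e i"
    unfolding is_skeleton_def by (elim exE conjE)
  show thesis
  proof (rule that)
    show "small elts S"
      using D(2) S(2) by (simp add: small_category_def full_subcategory_def)
    show "i \<in> \<Omega> \<and> i \<in> Hom K X (Ran K i)" if "i \<in> S" for i
      using S(1) that Omega_Hom by (auto simp: under_category_def)
    fix e assume "e \<in> \<Omega>" "Dom K e = X"
    then have "e \<in> Ob ?C"
      by (simp add: under_category_def)
    then obtain i where "i \<in> S" "isomorphic ?C e i"
      using S(3) by (meson ex1_implies_ex)
    moreover then obtain f g where "f \<in> Hom ?C e i" "g \<in> Hom ?C i e"
      unfolding isomorphic_def by blast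
    ultimately show "\<exists>i \<in> S. (\<exists>k \<in> Hom K (Ran K e) (Ran K i). k \<cdot> e = i) \<and>
               (\<exists>k \<in> Hom K (Ran K i) (Ran K e). k \<cdot> i = e)"
      using under_category_HomD by blast
  qed
qed

text \<open>The second clause admits any \<alpha> into \<open>Y\<close>: the identity will give
  minimality, the general case the action on morphisms.\<close>

lemma extension_natural_exists:
  assumes Y: "Y \<in> Ob K"
  obtains \<rho> where "is_extension K \<Omega> \<Phi> Y \<rho>"
    "\<And>X \<alpha> \<sigma>. \<alpha> \<in> Hom K X Y \<Longrightarrow> is_extension K \<Omega> \<Phi> X \<sigma> \<Longrightarrow>
       \<exists>\<delta> \<in> Hom K (Ran K \<sigma>) (Ran K \<rho>). \<delta> \<cdot> \<sigma> = \<rho> \<cdot> \<alpha>"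
proof -
  obtain S where S: "small elts S" "\<And>i. i \<in> S \<Longrightarrow> i \<in> \<Omega> \<and> i \<in> Hom K Y (Ran K i)"
    "\<And>e. e \<in> \<Omega> \<Longrightarrow> Dom K e = Y \<Longrightarrow>
       \<exists>i \<in> S. (\<exists>k \<in> Hom K (Ran K e) (Ran K i). k \<cdot> e = i) \<and>
               (\<exists>k \<in> Hom K (Ran K i) (Ran K e). k \<cdot> i = e)"
    using skeleton_representatives[OF Y] by blast
  \<comment> \<open>\<Phi> may be a proper class; indexing by representatives in \<open>S\<close>
    keeps the product small. Here \<open>i\<close> factors through an \<Omega>-part
    \<open>e\<close>, so a factorization of \<open>e \<cdot> \<alpha>\<close> passes on to
    \<open>i \<cdot> \<alpha>\<close>.\<close>
  define I where "I = {i \<in> S. \<exists>\<phi> \<in> \<Phi>. \<exists>m e. is_factorization K \<Omega> \<phi> m e \<and> Dom K \<phi> = Y \<and>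
    (\<exists>k \<in> Hom K (Ran K e) (Ran K i). k \<cdot> e = i)}"
  have I: "i \<in> Hom K Y (Ran K i)" if "i \<in> I" for i
    using that S(2) by (auto simp: I_def)
  have "small elts I"
    by (rule small_subset[OF S(1)]) (auto simp: I_def)
  then obtain L p where L: "L \<in> Ob K" and p: "\<And>i. i \<in> I \<Longrightarrow> p i \<in> Hom K L (Ran K i)"
    and univ: "\<And>Z q. Z \<in> Ob K \<Longrightarrow> (\<And>i. i \<in> I \<Longrightarrow> q i \<in> Hom K Z (Ran K i)) \<Longrightarrow>
       \<exists>!h. h \<in> Hom K Z L \<and> (\<forall>i \<in> I. p i \<cdot> h = q i)"
    by (rule discrete_product[OF complete]) (use HomD(5)[OF I] in blast)+
  \<comment> \<open>The indices are morphisms out of \<open>Y\<close> and serve as their own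
    coordinates.\<close>
  obtain f where f: "f \<in> Hom K Y L" "\<And>i. i \<in> I \<Longrightarrow> p i \<cdot> f = i"
    using univ[OF Y, of "\<lambda>i. i"] I by blast
  obtain m \<rho> where fact: "is_factorization K \<Omega> f m \<rho>"
    using complementable HomD(1)[OF f(1)] unfolding mono_complementable_def by blast
  obtain A where \<rho>: "\<rho> \<in> Hom K Y A" "\<rho> \<in> \<Omega>" and m: "m \<in> Hom K A L" "m \<in> pre_down K \<Omega>"
    and f_eq: "f = m \<cdot> \<rho>"
    by (rule factorization_HomE[OF fact Omega_Mor f(1)])
  have A: "Ran K \<rho> = A"
    using HomD(3)[OF \<rho>(1)] .
  show thesis
  proof (rule that)
    show "is_extension K \<Omega> \<Phi> Y \<rho>"
    proof (rule extensionI[OF \<rho>(2,1)])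
      fix \<phi> B assume \<phi>: "\<phi> \<in> \<Phi>" "\<phi> \<in> Hom K Y B"
      obtain n e where ne: "is_factorization K \<Omega> \<phi> n e"
        using complementable HomD(1)[OF \<phi>(2)] unfolding mono_complementable_def by blast
      obtain C where e: "e \<in> Hom K Y C" "e \<in> \<Omega>" and n: "n \<in> Hom K C B" and \<phi>_eq: "\<phi> = n \<cdot> e"
        by (rule factorization_HomE[OF ne Omega_Mor \<phi>(2)])
      \<comment> \<open>Both triangles are used: one puts \<open>i\<close> into \<open>I\<close>,
        the other recovers \<open>e\<close> from \<open>i\<close>.\<close>
      obtain i k where i: "i \<in> S" "\<exists>k \<in> Hom K (Ran K e) (Ran K i). k \<cdot> e = i"
        and k: "k \<in> Hom K (Ran K i) C" "k \<cdot> i = e"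
        using S(3)[OF e(2)] HomD(2,3)[OF e(1)] by metis
      have iI: "i \<in> I"
        using i \<phi>(1) ne HomD(2)[OF \<phi>(2)] unfolding I_def by blast
      note pm = Comp_in_Hom[OF m(1) p[OF iI]]
      note kpm = Comp_in_Hom[OF pm k(1)]
      \<comment> \<open>The extension of \<phi>: project to coordinate \<open>i\<close>, pass to
        \<open>e\<close> by \<open>k\<close>, then apply \<open>n\<close>.\<close>
      have "(n \<cdot> (k \<cdot> (p i \<cdot> m))) \<cdot> \<rho> = n \<cdot> (k \<cdot> (p i \<cdot> f))"
        using Comp_assoc[OF \<rho>(1) kpm n] Comp_assoc[OF \<rho>(1) pm k(1)]
          Comp_assoc[OF \<rho>(1) m(1) p[OF iI]] f_eq by simp
      then show "\<exists>\<phi>' \<in> Hom K A B. \<phi> = \<phi>' \<cdot> \<rho>"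
        using Comp_in_Hom[OF kpm n] f(2)[OF iI] k(2) \<phi>_eq by metis
    qed
  next
    fix X \<alpha> \<sigma> assume \<alpha>: "\<alpha> \<in> Hom K X Y" and ext: "is_extension K \<Omega> \<Phi> X \<sigma>"
    define X' where "X' = Ran K \<sigma>"
    note \<sigma> = extensionD(1,2)[OF ext, folded X'_def]
    have "\<exists>d \<in> Hom K X' (Ran K i). d \<cdot> \<sigma> = i \<cdot> \<alpha>" if iI: "i \<in> I" for i
    proof -
      obtain \<phi> n e k where \<phi>: "\<phi> \<in> \<Phi>" "Dom K \<phi> = Y" and ne: "is_factorization K \<Omega> \<phi> n e"
        and k: "k \<in> Hom K (Ran K e) (Ran K i)" "k \<cdot> e = i"
        using iI by (auto simp: I_def)
      have \<phi>H: "\<phi> \<in> Hom K Y (Ran K \<phi>)"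
        using \<phi> Phi_Mor Mor_in_Hom by blast
      obtain C where e: "e \<in> Hom K Y C" and n: "n \<in> Hom K C (Ran K \<phi>)" "n \<in> pre_down K \<Omega>"
        and \<phi>_eq: "\<phi> = n \<cdot> e"
        by (rule factorization_HomE[OF ne Omega_Mor \<phi>H])
      have k1: "k \<in> Hom K C (Ran K i)"
        using k(1) HomD(3)[OF e] by simp
      \<comment> \<open>The right ideal property turns \<phi>, which starts at \<open>Y\<close>,
        into a morphism of \<Phi> starting at \<open>X\<close>, where \<sigma> can extend
        it.\<close>
      have "\<phi> \<cdot> \<alpha> \<in> \<Phi>"
        using Phi_comp[OF \<phi>(1)] HomD[OF \<alpha>] \<phi>(2) by simp
      then obtain \<psi> where \<psi>: "\<psi> \<in> Hom K X' (Ran K \<phi>)" "\<phi> \<cdot> \<alpha> = \<psi> \<cdot> \<sigma>"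
        using extensionD(4)[OF ext _ Comp_in_Hom[OF \<alpha> \<phi>H]] X'_def by blast
      \<comment> \<open>First square: its diagonal factors \<open>e \<cdot> \<alpha>\<close> through
        \<sigma>, and \<open>k\<close> carries this to coordinate \<open>i\<close>.\<close>
      have "n \<cdot> (e \<cdot> \<alpha>) = \<psi> \<cdot> \<sigma>"
        using Comp_assoc[OF \<alpha> e n(1)] \<phi>_eq \<psi>(2) by simp
      then obtain d where d: "d \<in> Hom K X' C" "d \<cdot> \<sigma> = e \<cdot> \<alpha>"
        using pre_down_lift[OF n(2) \<sigma>(1) n(1) \<sigma>(2) Comp_in_Hom[OF \<alpha> e] \<psi>(1)] by blast
      have "(k \<cdot> d) \<cdot> \<sigma> = i \<cdot> \<alpha>"
        using Comp_assoc[OF \<sigma>(2) d(1) k1] Comp_assoc[OF \<alpha> e k1] d(2) k(2) by simp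
      then show ?thesis
        using Comp_in_Hom[OF d(1) k1] by blast
    qed
    then obtain d where d: "\<And>i. i \<in> I \<Longrightarrow> d i \<in> Hom K X' (Ran K i)"
      "\<And>i. i \<in> I \<Longrightarrow> d i \<cdot> \<sigma> = i \<cdot> \<alpha>"
      by metis
    obtain h where h: "h \<in> Hom K X' L" "\<And>i. i \<in> I \<Longrightarrow> p i \<cdot> h = d i"
      using univ[OF HomD(5)[OF \<sigma>(2)], of d] d(1) by blast
    have "p i \<cdot> (h \<cdot> \<sigma>) = i \<cdot> \<alpha> \<and> p i \<cdot> (f \<cdot> \<alpha>) = i \<cdot> \<alpha>" if iI: "i \<in> I" for i
      using Comp_assoc[OF \<sigma>(2) h(1) p[OF iI]] Comp_assoc[OF \<alpha> f(1) p[OF iI]]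
        h(2)[OF iI] d(2)[OF iI] f(2)[OF iI] by simp
    \<comment> \<open>Both sides have coordinates \<open>i \<cdot> \<alpha>\<close>, so they agree
      by uniqueness into the product.\<close>
    then have "h \<cdot> \<sigma> = f \<cdot> \<alpha>"
      using univ[OF HomD(4)[OF \<alpha>], of "\<lambda>i. i \<cdot> \<alpha>"] Comp_in_Hom[OF \<alpha> I]
        Comp_in_Hom[OF \<sigma>(2) h(1)] Comp_in_Hom[OF \<alpha> f(1)] by blast
    \<comment> \<open>Second square, with \<open>m\<close> against \<sigma>; its diagonal is the
      required \<delta>.\<close>
    then have "m \<cdot> (\<rho> \<cdot> \<alpha>) = h \<cdot> \<sigma>"
      using Comp_assoc[OF \<alpha> \<rho>(1) m(1)] f_eq by simp
    then show "\<exists>\<delta> \<in> Hom K (Ran K \<sigma>) (Ran K \<rho>). \<delta> \<cdot> \<sigma> = \<rho> \<cdot> \<alpha>"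
      using pre_down_lift[OF m(2) \<sigma>(1) m(1) \<sigma>(2) Comp_in_Hom[OF \<alpha> \<rho>(1)] h(1)] A X'_def by blast
  qed
qed

section \<open>Existence and naturality of envelopes\<close>

text \<open>The naturality clause at \<open>Ident K X\<close> is the minimality demanded of an
  envelope.\<close>

lemma envelope_exists:
  assumes "X \<in> Ob K"
  shows "\<exists>\<rho>. is_envelope K \<Omega> \<Phi> X \<rho>"
proof -
  obtain \<rho> where \<rho>: "is_extension K \<Omega> \<Phi> X \<rho>"
    "\<And>W \<alpha> \<sigma>. \<alpha> \<in> Hom K W X \<Longrightarrow> is_extension K \<Omega> \<Phi> W \<sigma> \<Longrightarrow>
       \<exists>\<delta> \<in> Hom K (Ran K \<sigma>) (Ran K \<rho>). \<delta> \<cdot> \<sigma> = \<rho> \<cdot> \<alpha>"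
    using extension_natural_exists[OF assms] by blast
  show ?thesis
    using envelopeI[OF \<rho>(1)] \<rho>(2)[OF Ident_in_Hom[OF assms]] Ident_right[OF extensionD(2)[OF \<rho>(1)]]
    by metis
qed

text \<open>The given envelopes need not be the constructed ones:
  \<open>\<rho> \<cdot> \<alpha>\<close> factors through the extension \<open>eX\<close>, and
  minimality of \<open>eY\<close> takes \<rho> to \<open>eY\<close>. Uniqueness holds because
  \<open>eX\<close> is an epimorphism.\<close>

lemma envelope_natural:
  assumes "\<alpha> \<in> Hom K X Y" "is_envelope K \<Omega> \<Phi> X eX" "is_envelope K \<Omega> \<Phi> Y eY"
  shows "\<exists>!\<psi>. \<psi> \<in> Hom K (Ran K eX) (Ran K eY) \<and> \<psi> \<cdot> eX = eY \<cdot> \<alpha>"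
proof -
  note X = envelopeD(1)[OF assms(2)]
  note eX = extensionD(2)[OF X]
  obtain \<rho> where \<rho>: "is_extension K \<Omega> \<Phi> Y \<rho>"
    "\<And>W \<alpha> \<sigma>. \<alpha> \<in> Hom K W Y \<Longrightarrow> is_extension K \<Omega> \<Phi> W \<sigma> \<Longrightarrow>
       \<exists>\<delta> \<in> Hom K (Ran K \<sigma>) (Ran K \<rho>). \<delta> \<cdot> \<sigma> = \<rho> \<cdot> \<alpha>"
    using extension_natural_exists[OF HomD(5)[OF assms(1)]] by blast
  obtain \<delta> where \<delta>: "\<delta> \<in> Hom K (Ran K eX) (Ran K \<rho>)" "\<delta> \<cdot> eX = \<rho> \<cdot> \<alpha>"
    using \<rho>(2)[OF assms(1) X] by blast
  obtain \<upsilon> where \<upsilon>: "\<upsilon> \<in> Hom K (Ran K \<rho>) (Ran K eY)" "eY = \<upsilon> \<cdot> \<rho>"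
    using envelopeD(2)[OF assms(3) \<rho>(1)] by blast
  have "(\<upsilon> \<cdot> \<delta>) \<cdot> eX = eY \<cdot> \<alpha>"
    using Comp_assoc[OF eX \<delta>(1) \<upsilon>(1)] Comp_assoc[OF assms(1) extensionD(2)[OF \<rho>(1)] \<upsilon>(1)] \<delta>(2) \<upsilon>(2)
    by simp
  then show ?thesis
    using Comp_in_Hom[OF \<delta>(1) \<upsilon>(1)] epi_cancel[OF extensionD(3)[OF X] eX] by metis
qed

section \<open>The net of one-element families and its local limits\<close>

text \<open>Identities make a singleton directed, and the transition condition for \<alpha> is
  naturality of envelopes.\<close>

lemma envelope_net:
  assumes e: "\<And>X. X \<in> Ob K \<Longrightarrow> is_envelope K \<Omega> \<Phi> X (e X)"
  shows "is_net elts K (\<lambda>X. {e X})"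
proof -
  have ext: "is_extension K \<Omega> \<Phi> X (e X)" if "X \<in> Ob K" for X
    using envelopeD(1)[OF e[OF that]] .
  have "precedes K (e X) (e X)" if "X \<in> Ob K" for X
    using Ident_in_Hom[OF HomD(5)[OF extensionD(2)[OF ext[OF that]]]]
      Ident_left[OF extensionD(2)[OF ext[OF that]]] unfolding precedes_def by metis
  moreover have "Dom K (e X) = X" if "X \<in> Ob K" for X
    using HomD(2)[OF extensionD(2)[OF ext[OF that]]] .
  moreover have "\<exists>a \<in> Hom K (Ran K (e X)) (Ran K (e Y)). a \<cdot> e X = e Y \<cdot> \<alpha>"
    if "X \<in> Ob K" "Y \<in> Ob K" "\<alpha> \<in> Hom K X Y" for X Y \<alpha>
    using envelope_natural[OF that(3) e[OF that(1)] e[OF that(2)]] by blast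
  moreover have "\<exists>L p. is_system_limit K {e X} L p" if "X \<in> Ob K" for X
    using singleton_system_limit[OF extensionD(3)[OF ext[OF that]]] by blast
  ultimately show ?thesis
    unfolding is_net_def using small_singleton extensionD(3)[OF ext] by simp
qed

text \<open>The projective limit is chosen to be \<open>Ran K (e X)\<close> with the identity as
  projection.\<close>

lemma envelope_local_limit:
  assumes "is_envelope K \<Omega> \<Phi> X (e X)"
  shows "is_local_limit K (\<lambda>X. {e X}) X (e X)"
  unfolding is_local_limit_def
  using singleton_system_limit extensionD(2,3)[OF envelopeD(1)[OF assms]] Ident_left
  by (intro exI conjI) auto

text \<open>Whatever limit and factorization are chosen, \<epsilon> and \<open>e X\<close> factor
  through each other, which transports both defining properties.\<close>

lemma envelope_of_local_limit:
  assumes env: "is_envelope K \<Omega> \<Phi> X (e X)"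
    and "is_local_limit K (\<lambda>X. {e X}) X l" "is_factorization K \<Omega> l m \<epsilon>"
  shows "is_envelope K \<Omega> \<Phi> X \<epsilon>"
proof -
  define \<sigma> where "\<sigma> = e X"
  define E where "E = Ran K \<sigma>"
  note ext = envelopeD(1)[OF env, folded \<sigma>_def]
  note \<sigma> = extensionD(1-3)[OF ext, folded E_def]
  obtain L g h where l: "l \<in> Hom K X L" and g: "g \<in> Hom K L E" and h: "h \<in> Hom K E L"
    and gl: "g \<cdot> l = \<sigma>" and hs: "h \<cdot> \<sigma> = l"
    using singleton_local_limit[OF \<sigma>(3,2) assms(2) \<sigma>_def[symmetric]] by blast
  obtain A where \<epsilon>: "\<epsilon> \<in> Hom K X A" "\<epsilon> \<in> \<Omega>" and m: "m \<in> Hom K A L" "m \<in> pre_down K \<Omega>"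
    and l_eq: "l = m \<cdot> \<epsilon>"
    by (rule factorization_HomE[OF assms(3) Omega_Mor l])
  have A: "Ran K \<epsilon> = A"
    using HomD(3)[OF \<epsilon>(1)] .
  \<comment> \<open>Diagonal of the square
    \<open>m \<cdot> \<epsilon> = h \<cdot> \<sigma>\<close>.\<close>
  obtain d where d: "d \<in> Hom K E A" "d \<cdot> \<sigma> = \<epsilon>"
    using pre_down_lift[OF m(2) \<sigma>(1) m(1) \<sigma>(2) \<epsilon>(1) h] hs l_eq by metis
  note gm = Comp_in_Hom[OF m(1) g]
  have gm\<epsilon>: "(g \<cdot> m) \<cdot> \<epsilon> = \<sigma>"
    using Comp_assoc[OF \<epsilon>(1) m(1) g] gl l_eq by simp
  show ?thesis
  proof (rule envelopeI)
    show "is_extension K \<Omega> \<Phi> X \<epsilon>"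
    proof (rule extensionI[OF \<epsilon>(2,1)])
      fix \<phi> B assume "\<phi> \<in> \<Phi>" "\<phi> \<in> Hom K X B"
      then obtain \<psi> where \<psi>: "\<psi> \<in> Hom K E B" "\<phi> = \<psi> \<cdot> \<sigma>"
        using extensionD(4)[OF ext] E_def by blast
      then show "\<exists>\<phi>' \<in> Hom K A B. \<phi> = \<phi>' \<cdot> \<epsilon>"
        using Comp_assoc[OF \<epsilon>(1) gm \<psi>(1)] gm\<epsilon> Comp_in_Hom[OF gm \<psi>(1)] by metis
    qed
  next
    fix \<tau> assume \<tau>: "is_extension K \<Omega> \<Phi> X \<tau>"
    \<comment> \<open>Minimality leads from \<tau> to \<sigma>, and \<open>d\<close> leads on to
      \<epsilon>.\<close>
    obtain u where u: "u \<in> Hom K (Ran K \<tau>) E" "\<sigma> = u \<cdot> \<tau>"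
      using envelopeD(2)[OF env \<tau>] \<sigma>_def E_def by blast
    then show "\<exists>\<upsilon> \<in> Hom K (Ran K \<tau>) (Ran K \<epsilon>). \<epsilon> = \<upsilon> \<cdot> \<tau>"
      using Comp_assoc[OF extensionD(2)[OF \<tau>] u(1) d(1)] d(2) Comp_in_Hom[OF u(1) d(1)] A by metis
  qed
qed

section \<open>Functoriality\<close>

text \<open>Both functor laws come from uniqueness: the identity and the composite solve the
  equations that define \<open>E\<close> there.\<close>

lemma envelope_functor:
  assumes e: "\<And>X. X \<in> Ob K \<Longrightarrow> is_envelope K \<Omega> \<Phi> X (e X)"
  shows "\<exists>E. is_envelope_functor K \<Omega> \<Phi> e E"
proof -
  define E where "E \<alpha> = (THE \<psi>. \<psi> \<in> Hom K (Ran K (e (Dom K \<alpha>))) (Ran K (e (Ran K \<alpha>))) \<and>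
    \<psi> \<cdot> e (Dom K \<alpha>) = e (Ran K \<alpha>) \<cdot> \<alpha>)" for \<alpha>
  have eX: "e X \<in> Hom K X (Ran K (e X))" if "X \<in> Ob K" for X
    using extensionD(2)[OF envelopeD(1)[OF e[OF that]]] .
  have ex1: "\<exists>!\<psi>. \<psi> \<in> Hom K (Ran K (e X)) (Ran K (e Y)) \<and> \<psi> \<cdot> e X = e Y \<cdot> \<alpha>"
    if "\<alpha> \<in> Hom K X Y" for X Y \<alpha>
    using envelope_natural[OF that e[OF HomD(4)[OF that]] e[OF HomD(5)[OF that]]] .
  have E: "E \<alpha> \<in> Hom K (Ran K (e X)) (Ran K (e Y))" "E \<alpha> \<cdot> e X = e Y \<cdot> \<alpha>"
    if "\<alpha> \<in> Hom K X Y" for X Y \<alpha>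
    using theI'[OF ex1[OF that]] HomD(2,3)[OF that] unfolding E_def by auto
  have E_eq: "E \<alpha> = \<psi>"
    if "\<alpha> \<in> Hom K X Y" "\<psi> \<in> Hom K (Ran K (e X)) (Ran K (e Y))" "\<psi> \<cdot> e X = e Y \<cdot> \<alpha>" for X Y \<alpha> \<psi>
    using ex1[OF that(1)] E[OF that(1)] that(2,3) by blast
  have "E (Ident K X) = Ident K (Ran K (e X))" if "X \<in> Ob K" for X
    by (rule E_eq[OF Ident_in_Hom[OF that] Ident_in_Hom[OF HomD(5)[OF eX[OF that]]]])
      (simp add: Ident_left[OF eX[OF that]] Ident_right[OF eX[OF that]])
  moreover have "E (\<beta> \<cdot> \<alpha>) = E \<beta> \<cdot> E \<alpha>"
    if \<alpha>\<beta>: "\<alpha> \<in> Mor K" "\<beta> \<in> Mor K" "Ran K \<alpha> = Dom K \<beta>" for \<alpha> \<beta>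
  proof -
    obtain X Y Z where \<alpha>: "\<alpha> \<in> Hom K X Y" and \<beta>: "\<beta> \<in> Hom K Y Z"
      using Mor_in_Hom[OF \<alpha>\<beta>(1)] Mor_in_Hom[OF \<alpha>\<beta>(2)] \<alpha>\<beta>(3) by simp
    note eX = eX[OF HomD(4)[OF \<alpha>]] and eY = eX[OF HomD(4)[OF \<beta>]] and eZ = eX[OF HomD(5)[OF \<beta>]]
    show ?thesis
    proof (rule E_eq[OF Comp_in_Hom[OF \<alpha> \<beta>] Comp_in_Hom[OF E(1)[OF \<alpha>] E(1)[OF \<beta>]]])
      \<comment> \<open>The two naturality squares are pasted along \<open>e Y\<close>.\<close>
      show "(E \<beta> \<cdot> E \<alpha>) \<cdot> e X = e Z \<cdot> (\<beta> \<cdot> \<alpha>)"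
        using Comp_assoc[OF eX E(1)[OF \<alpha>] E(1)[OF \<beta>]] Comp_assoc[OF \<alpha> eY E(1)[OF \<beta>]]
          Comp_assoc[OF \<alpha> \<beta> eZ] E(2)[OF \<alpha>] E(2)[OF \<beta>] by simp
    qed
  qed
  ultimately have "is_envelope_functor K \<Omega> \<Phi> e E"
    unfolding is_envelope_functor_def using e E by blast
  then show ?thesis by blast
qed

end

text \<open>Local limits and factorizations depend on choices, so (a) is claimed for all of them,
  with an existence clause that keeps the claim from being vacuous.\<close>

theorem theorem0p1p25:
  fixes elts :: "'v \<Rightarrow> 'v set"
    and K :: "('v, 'v) cat"
    and \<Omega> \<Phi> :: "'v set"
  assumes "mk_universe elts"
    and "category K"
    and "\<Omega> \<subseteq> Mor K"
    and "\<Phi> \<subseteq> Mor K"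
    and RE1: "projectively_complete elts K"
    and RE2: "mono_complementable K \<Omega>"
    and RE3: "co_well_powered elts K \<Omega>"
    and RE4: "\<forall>X \<in> Ob K. \<exists>\<phi> \<in> \<Phi>. Dom K \<phi> = X"
             "\<forall>\<phi> \<in> \<Phi>. \<forall>\<alpha> \<in> Mor K. Ran K \<alpha> = Dom K \<phi> \<longrightarrow> \<phi> \<cdot>\<^bsub>K\<^esub> \<alpha> \<in> \<Phi>"
  shows "(\<exists>N. is_net elts K N \<and>
           (\<forall>X \<in> Ob K.
              (\<exists>l m e. is_local_limit K N X l \<and> is_factorization K \<Omega> l m e) \<and>
              (\<forall>l m e. is_local_limit K N X l \<and> is_factorization K \<Omega> l m e \<longrightarrow>
                 is_envelope K \<Omega> \<Phi> X e))) \<and>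
         (\<forall>X \<in> Ob K. \<forall>Y \<in> Ob K. \<forall>\<alpha> \<in> Hom K X Y. \<forall>eX eY.
           is_envelope K \<Omega> \<Phi> X eX \<and> is_envelope K \<Omega> \<Phi> Y eY \<longrightarrow>
           (\<exists>!\<psi>. \<psi> \<in> Hom K (Ran K eX) (Ran K eY) \<and> \<psi> \<cdot>\<^bsub>K\<^esub> eX = eY \<cdot>\<^bsub>K\<^esub> \<alpha>)) \<and>
         (\<exists>e E. is_envelope_functor K \<Omega> \<Phi> e E)"
proof -
  interpret regular_envelope elts K \<Omega> \<Phi>
    using assms by (simp add: regular_envelope_def regular_envelope_axioms_def)
  obtain e where e: "\<And>X. X \<in> Ob K \<Longrightarrow> is_envelope K \<Omega> \<Phi> X (e X)"
    using envelope_exists by metis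
  \<comment> \<open>The envelope \<open>e X\<close> serves as the local limit, and complementability
    of \<Omega> factors it.\<close>
  have "\<exists>l m \<epsilon>. is_local_limit K (\<lambda>X. {e X}) X l \<and> is_factorization K \<Omega> l m \<epsilon>" if "X \<in> Ob K" for X
    using envelope_local_limit[where e = e, OF e[OF that]] extensionD(2)[OF envelopeD(1)[OF e[OF that]]] RE2
    unfolding mono_complementable_def by (meson HomD(1))
  then show ?thesis
    using envelope_net[OF e] envelope_of_local_limit[where e = e, OF e] envelope_natural envelope_functor[OF e]
    by (intro conjI exI[of _ "\<lambda>X. {e X}"] ballI allI impI) (blast | simp)+
qed

end
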